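(* Let $q$ be a prime power, $k\ge1$, let $S=S_f\subset\mathbb{P}^n$ be a hypersurface of degree $d\ge2$ defined by a homogeneous $f\in\mathbb{F}_q[x_0,\dots,x_n]$, and let $\Sigma\subset S$ be its set of singular points. Let $S_k\subset\mathbb{P}^{n+k}$ be the cone over $S$, i.e. the hypersurface defined by $F(x_0,\dots,x_{n+k})=f(x_0,\dots,x_n)$. Then $S_k$ is singular at a point $(x_0:x_1:\cdots:x_{n+k})$ if and only if $x_0=x_1=\cdots=x_n=0$ or $(x_0:x_1:\cdots:x_n)\in\Sigma$.
   Context: $\mathbb{P}^n$ is projective $n$-space over $\overline{\mathbb{F}_q}$, and $S_f=\{f=0\}\subset\mathbb{P}^n$. $S_f$ is singular at a point $P$ if $f(P)=0$ and $\nabla f(P)=0$. *)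

theory Defs
  imports
    "HOL-Algebra.Algebraic_Closure_Type"
    "HOL-Number_Theory.Prime_Powers"
    "HOL-Library.Poly_Mapping"
begin

(* Polynomials in the variables x_0, x_1, x_2, ...: a monomial is a finitely supported
   exponent vector, a polynomial a finitely supported family of coefficients.
   The ring R[x_0,...,x_n] is the subset polys_upto n, so that R[x_0,...,x_n] is literally
   contained in R[x_0,...,x_{n+k}]. In particular the polynomial F in n+k+1 variables with
   F(x_0,...,x_{n+k}) = f(x_0,...,x_n) is f itself, regarded in the larger ring. *)
type_synonym 'a mpoly = "(nat \<Rightarrow>\<^sub>0 nat) \<Rightarrow>\<^sub>0 'a"

definition polys_upto :: "nat \<Rightarrow> 'a::zero mpoly set" where
  "polys_upto n = {f. \<forall>m\<in>Poly_Mapping.keys f. Poly_Mapping.keys m \<subseteq> {..n}}"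

definition monom_degree :: "(nat \<Rightarrow>\<^sub>0 nat) \<Rightarrow> nat" where
  "monom_degree m = (\<Sum>i\<in>Poly_Mapping.keys m. Poly_Mapping.lookup m i)"

(* The zero polynomial is homogeneous of every degree. *)
definition homogeneous :: "nat \<Rightarrow> 'a::zero mpoly \<Rightarrow> bool" where
  "homogeneous d f \<longleftrightarrow> (\<forall>m\<in>Poly_Mapping.keys f. monom_degree m = d)"

definition eval_mpoly :: "'a::comm_semiring_1 mpoly \<Rightarrow> (nat \<Rightarrow> 'a) \<Rightarrow> 'a" where
  "eval_mpoly f x =
     (\<Sum>m\<in>Poly_Mapping.keys f. Poly_Mapping.lookup f m *
        (\<Prod>i\<in>Poly_Mapping.keys m. x i ^ Poly_Mapping.lookup m i))"

(* Formal partial derivative with respect to x_i. If x_i does not occur in m, the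
   truncated exponent is harmless because the coefficient vanishes. *)
definition partial_deriv :: "nat \<Rightarrow> 'a::comm_semiring_1 mpoly \<Rightarrow> 'a mpoly" where
  "partial_deriv i f =
     (\<Sum>m\<in>Poly_Mapping.keys f. Poly_Mapping.single (m - Poly_Mapping.single i 1)
                    (of_nat (Poly_Mapping.lookup m i) * Poly_Mapping.lookup f m))"

definition extend_scalars :: "'a::field mpoly \<Rightarrow> 'a alg_closure mpoly" where
  "extend_scalars f = Poly_Mapping.map to_ac f"

(* K^{n+1} minus the origin; coordinates beyond n are set to 0 so that equality of
   functions is equality of coordinate vectors. *)
definition nonzero_vectors :: "nat \<Rightarrow> (nat \<Rightarrow> 'a::field) set" where
  "nonzero_vectors n = {x. (\<forall>i>n. x i = 0) \<and> (\<exists>i\<le>n. x i \<noteq> 0)}"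

definition proj_rel :: "nat \<Rightarrow> ((nat \<Rightarrow> 'a::field) \<times> (nat \<Rightarrow> 'a)) set" where
  "proj_rel n = {(x, y). x \<in> nonzero_vectors n \<and> y \<in> nonzero_vectors n \<and>
                         (\<exists>c. c \<noteq> 0 \<and> y = (\<lambda>i. c * x i))}"

lemma equiv_proj_rel: "equiv (nonzero_vectors n) (proj_rel n)"
proof (rule equivI)
  show "refl_on (nonzero_vectors n) (proj_rel n)"
    unfolding refl_on_def proj_rel_def by (auto intro!: exI[of _ 1])
  show "proj_rel n \<subseteq> nonzero_vectors n \<times> nonzero_vectors n"
    unfolding proj_rel_def by auto
  show "sym (proj_rel n)"
  proof (rule symI)
    fix x y
    assume "(x, y) \<in> proj_rel n"
    then obtain c where "x \<in> nonzero_vectors n" "y \<in> nonzero_vectors n"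
      and c: "c \<noteq> 0" "y = (\<lambda>i. c * x i)"
      unfolding proj_rel_def by auto
    moreover from c have "x = (\<lambda>i. inverse c * y i)" by (simp add: fun_eq_iff)
    moreover from c have "inverse c \<noteq> 0" by simp
    ultimately show "(y, x) \<in> proj_rel n" unfolding proj_rel_def by blast
  qed
  show "trans (proj_rel n)"
  proof (rule transI)
    fix x y z
    assume "(x, y) \<in> proj_rel n" "(y, z) \<in> proj_rel n"
    then obtain c c' where "x \<in> nonzero_vectors n" "z \<in> nonzero_vectors n"
      and "c \<noteq> 0" "y = (\<lambda>i. c * x i)" "c' \<noteq> 0" "z = (\<lambda>i. c' * y i)"
      unfolding proj_rel_def by auto
    moreover from this have "c' * c \<noteq> 0" "z = (\<lambda>i. (c' * c) * x i)"
      by (simp_all add: mult.assoc)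
    ultimately show "(x, z) \<in> proj_rel n" unfolding proj_rel_def by blast
  qed
qed

definition proj_space :: "nat \<Rightarrow> (nat \<Rightarrow> 'a::field) set set" where
  "proj_space n = nonzero_vectors n // proj_rel n"

(* The point (x_0 : ... : x_n). Only the coordinates x_0,...,x_n of x are used.
   If they all vanish, the result is the empty set, which is not in proj_space n. *)
definition proj_point :: "nat \<Rightarrow> (nat \<Rightarrow> 'a::field) \<Rightarrow> (nat \<Rightarrow> 'a) set" where
  "proj_point n x = proj_rel n `` {\<lambda>i. if i \<le> n then x i else 0}"

lemma proj_point_in_proj_space_iff:
  "proj_point n x \<in> proj_space n \<longleftrightarrow> (\<exists>i\<le>n. x i \<noteq> 0)"
proof
  assume "\<exists>i\<le>n. x i \<noteq> 0"
  then have "(\<lambda>i. if i \<le> n then x i else 0) \<in> nonzero_vectors n"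
    unfolding nonzero_vectors_def by auto
  then show "proj_point n x \<in> proj_space n"
    unfolding proj_point_def proj_space_def by (rule quotientI)
next
  assume "proj_point n x \<in> proj_space n"
  then have "proj_point n x \<noteq> {}"
    unfolding proj_space_def using in_quotient_imp_non_empty[OF equiv_proj_rel] by blast
  then show "\<exists>i\<le>n. x i \<noteq> 0"
    unfolding proj_point_def proj_rel_def nonzero_vectors_def by auto
qed

(* In the next two definitions f is meant to be a homogeneous polynomial in x_0,...,x_n;
   then the vanishing of f, or of a partial derivative of f, does not depend on the
   representative x of P. *)
definition hypersurface :: "nat \<Rightarrow> 'a::field mpoly \<Rightarrow> (nat \<Rightarrow> 'a alg_closure) set set" where
  "hypersurface n f = {P \<in> proj_space n. \<forall>x\<in>P. eval_mpoly (extend_scalars f) x = 0}"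

definition singular_at :: "nat \<Rightarrow> 'a::field mpoly \<Rightarrow> (nat \<Rightarrow> 'a alg_closure) set \<Rightarrow> bool" where
  "singular_at n f P \<longleftrightarrow> P \<in> hypersurface n f \<and>
     (\<forall>x\<in>P. \<forall>i\<le>n. eval_mpoly (partial_deriv i (extend_scalars f)) x = 0)"

definition singular_points :: "nat \<Rightarrow> 'a::field mpoly \<Rightarrow> (nat \<Rightarrow> 'a alg_closure) set set" where
  "singular_points n f = {P \<in> hypersurface n f. singular_at n f P}"

end

theory Submission
  imports Defs
begin

(* For homogeneous f, vanishing of f and of its partial derivatives at a point can be tested on
   any single coordinate vector. Both f and its derivatives involve only x_0,...,x_n, the
   derivatives in the cone variables are zero, and at the vertex x_0 = ... = x_n = 0 everything
   vanishes because f and its derivatives have positive degrees d and d - 1. *)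

definition eval_monom :: "(nat \<Rightarrow>\<^sub>0 nat) \<Rightarrow> (nat \<Rightarrow> 'a::comm_semiring_1) \<Rightarrow> 'a" where
  "eval_monom m x = (\<Prod>i\<in>Poly_Mapping.keys m. x i ^ Poly_Mapping.lookup m i)"

lemma eval_mpoly_eval_monom:
  "eval_mpoly f x = (\<Sum>m\<in>Poly_Mapping.keys f. Poly_Mapping.lookup f m * eval_monom m x)"
  by (simp add: eval_mpoly_def eval_monom_def)

lemma eval_monom_scale:
  "eval_monom m (\<lambda>i. c * x i) = c ^ monom_degree m * eval_monom m x"
  by (simp add: eval_monom_def monom_degree_def power_mult_distrib prod.distrib power_sum)

lemma eval_mpoly_scale:
  assumes "homogeneous d f"
  shows "eval_mpoly f (\<lambda>i. c * x i) = c ^ d * eval_mpoly f x"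
  unfolding eval_mpoly_eval_monom sum_distrib_left
proof (rule sum.cong[OF refl])
  fix m assume "m \<in> Poly_Mapping.keys f"
  with assms have "monom_degree m = d"
    by (simp add: homogeneous_def)
  then show "Poly_Mapping.lookup f m * eval_monom m (\<lambda>i. c * x i) =
      c ^ d * (Poly_Mapping.lookup f m * eval_monom m x)"
    by (simp add: eval_monom_scale mult.left_commute)
qed

text \<open>This allows one vector \<open>x\<close> with n+k+1 coordinates to stand both for a point
  of the cone's ambient space and, after truncation, for a point of P^n.\<close>

lemma eval_mpoly_cong:
  assumes "f \<in> polys_upto n" and "\<And>i. i \<le> n \<Longrightarrow> x i = y i"
  shows "eval_mpoly f x = eval_mpoly f y"
  unfolding eval_mpoly_def
proof (rule sum.cong[OF refl])
  fix m assume "m \<in> Poly_Mapping.keys f"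
  with assms(1) have "Poly_Mapping.keys m \<subseteq> {..n}"
    by (simp add: polys_upto_def)
  then have "(\<Prod>i\<in>Poly_Mapping.keys m. x i ^ Poly_Mapping.lookup m i) =
      (\<Prod>i\<in>Poly_Mapping.keys m. y i ^ Poly_Mapping.lookup m i)"
    using assms(2) by (intro prod.cong refl) (metis atMost_iff subsetD)
  then show "Poly_Mapping.lookup f m * (\<Prod>i\<in>Poly_Mapping.keys m. x i ^ Poly_Mapping.lookup m i) =
      Poly_Mapping.lookup f m * (\<Prod>i\<in>Poly_Mapping.keys m. y i ^ Poly_Mapping.lookup m i)"
    by (rule arg_cong)
qed

text \<open>On the relevant coordinates \<open>x\<close> equals \<open>0 * x\<close>, so scaling by
  0 gives the factor 0^d. Positivity of \<open>d\<close> matters because 0^0 = 1.\<close>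

lemma eval_mpoly_eq_0:
  assumes "f \<in> polys_upto n" and "homogeneous d f" and "d > 0" and "\<And>i. i \<le> n \<Longrightarrow> x i = 0"
  shows "eval_mpoly f x = 0"
proof -
  have "eval_mpoly f x = eval_mpoly f (\<lambda>i. 0 * x i)"
    using assms by (intro eval_mpoly_cong[of f n]) auto
  also have "\<dots> = 0"
    unfolding eval_mpoly_scale[OF assms(2)] using assms(3) by (simp add: power_0_left)
  finally show ?thesis .
qed

lemma monom_degree_superset:
  assumes "finite A" and "Poly_Mapping.keys m \<subseteq> A"
  shows "monom_degree m = (\<Sum>i\<in>A. Poly_Mapping.lookup m i)"
  unfolding monom_degree_def
  using assms by (intro sum.mono_neutral_left) (auto simp: in_keys_iff)

lemma monom_degree_add: "monom_degree (a + b) = monom_degree a + monom_degree b"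
proof -
  have "Poly_Mapping.keys (a + b) \<subseteq> Poly_Mapping.keys a \<union> Poly_Mapping.keys b"
    by (rule Poly_Mapping.keys_add)
  then show ?thesis
    using monom_degree_superset[of "Poly_Mapping.keys a \<union> Poly_Mapping.keys b"]
    by (simp add: lookup_add sum.distrib)
qed

lemma monom_degree_diff_single:
  assumes "Poly_Mapping.lookup m i \<noteq> 0"
  shows "monom_degree (m - Poly_Mapping.single i 1) = monom_degree m - 1"
proof -
  \<comment> \<open>Subtraction of exponent vectors is truncated; adding back restores
    \<open>m\<close> because x_i occurs in it.\<close>
  have "m = (m - Poly_Mapping.single i 1) + Poly_Mapping.single i 1"
    using assms by (intro poly_mapping_eqI) (auto simp: lookup_add lookup_minus lookup_single when_def)
  then have "monom_degree m =
      monom_degree (m - Poly_Mapping.single i 1) + monom_degree (Poly_Mapping.single i 1)"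
    by (subst monom_degree_add[symmetric]) (rule arg_cong)
  moreover have "monom_degree (Poly_Mapping.single i 1) = 1"
    by (simp add: monom_degree_def)
  ultimately show ?thesis by simp
qed

text \<open>A monomial without x_i contributes the coefficient 0 and disappears. The rule goes in
  one direction only, since the characteristic may divide an exponent and kill further
  terms.\<close>

lemma keys_partial_deriv:
  assumes "m' \<in> Poly_Mapping.keys (partial_deriv i f)"
  obtains m where "m \<in> Poly_Mapping.keys f" and "Poly_Mapping.lookup m i \<noteq> 0"
    and "m' = m - Poly_Mapping.single i 1"
proof -
  from assms obtain m where "m \<in> Poly_Mapping.keys f"
    and "m' \<in> Poly_Mapping.keys (Poly_Mapping.single (m - Poly_Mapping.single i 1)
           (of_nat (Poly_Mapping.lookup m i) * Poly_Mapping.lookup f m))"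
    unfolding partial_deriv_def by (rule UN_E[OF subsetD[OF Poly_Mapping.keys_sum]])
  with that show thesis
    by (cases "Poly_Mapping.lookup m i = 0") (auto split: if_splits)
qed

text \<open>The truncation of \<open>d - 1\<close> at \<open>d = 0\<close> is harmless: the
  derivative of a constant is zero, which is homogeneous of every degree.\<close>

lemma homogeneous_partial_deriv:
  assumes "homogeneous d f"
  shows "homogeneous (d - 1) (partial_deriv i f)"
  unfolding homogeneous_def
proof
  fix m' assume "m' \<in> Poly_Mapping.keys (partial_deriv i f)"
  then obtain m where "m \<in> Poly_Mapping.keys f" "Poly_Mapping.lookup m i \<noteq> 0"
    "m' = m - Poly_Mapping.single i 1"
    by (rule keys_partial_deriv)
  with assms show "monom_degree m' = d - 1"
    using monom_degree_diff_single[of m i] by (simp add: homogeneous_def)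
qed

lemma polys_upto_partial_deriv:
  assumes "f \<in> polys_upto n"
  shows "partial_deriv i f \<in> polys_upto n"
proof -
  have "Poly_Mapping.keys m' \<subseteq> {..n}" if "m' \<in> Poly_Mapping.keys (partial_deriv i f)" for m'
  proof -
    from that obtain m where m: "m \<in> Poly_Mapping.keys f" "m' = m - Poly_Mapping.single i 1"
      by (rule keys_partial_deriv)
    then have "Poly_Mapping.keys m' \<subseteq> Poly_Mapping.keys m"
      by (auto simp: in_keys_iff lookup_minus)
    with m(1) assms show ?thesis
      by (auto simp: polys_upto_def)
  qed
  then show ?thesis
    by (simp add: polys_upto_def)
qed

text \<open>For the cone variables: x_i occurs in no monomial of \<open>f\<close>, so every exponent
  factor is 0.\<close>

lemma partial_deriv_eq_0:
  assumes "f \<in> polys_upto n" and "i > n"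
  shows "partial_deriv i f = 0"
proof -
  have "Poly_Mapping.lookup m i = 0" if "m \<in> Poly_Mapping.keys f" for m
    using assms that by (force simp: polys_upto_def in_keys_iff)
  then show ?thesis
    by (simp add: partial_deriv_def)
qed

lemma keys_extend_scalars: "Poly_Mapping.keys (extend_scalars f) \<subseteq> Poly_Mapping.keys f"
  by (auto simp: extend_scalars_def in_keys_iff map.rep_eq when_def)

lemma polys_upto_extend_scalars: "f \<in> polys_upto n \<Longrightarrow> extend_scalars f \<in> polys_upto n"
  using keys_extend_scalars[of f] unfolding polys_upto_def by blast

lemma homogeneous_extend_scalars: "homogeneous d f \<Longrightarrow> homogeneous d (extend_scalars f)"
  using keys_extend_scalars[of f] unfolding homogeneous_def by blast

text \<open>Replaces the quantifier over all representatives by evaluation at \<open>x\<close>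
  itself. Coordinates of \<open>x\<close> beyond \<open>n\<close> may be nonzero, so the same
  \<open>x\<close> can be used for both \<open>n\<close> and \<open>n + k\<close>.\<close>

lemma singular_at_proj_point_iff:
  fixes f :: "'a::field mpoly" and x :: "nat \<Rightarrow> 'a alg_closure"
  assumes f: "f \<in> polys_upto n" "homogeneous d f" and x: "\<exists>i\<le>n. x i \<noteq> 0"
  shows "singular_at n f (proj_point n x) \<longleftrightarrow> eval_mpoly (extend_scalars f) x = 0 \<and>
    (\<forall>i\<le>n. eval_mpoly (partial_deriv i (extend_scalars f)) x = 0)"
proof -
  define x' where "x' = (\<lambda>i. if i \<le> n then x i else 0)"
  have x': "x' \<in> nonzero_vectors n"
    using x by (auto simp: x'_def nonzero_vectors_def)
  have self: "x' \<in> proj_point n x"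
    using equiv_class_self[OF equiv_proj_rel x'] by (simp add: proj_point_def x'_def)
  \<comment> \<open>Each representative is a multiple of the truncated vector \<open>x'\<close>, and
    scaling by \<open>c\<close> multiplies the value by c^e. The degree \<open>e\<close> is left
    free to cover both \<open>f\<close> and its derivatives.\<close>
  have vanish: "(\<forall>y\<in>proj_point n x. eval_mpoly g y = 0) \<longleftrightarrow> eval_mpoly g x = 0"
    if g: "g \<in> polys_upto n" "homogeneous e g" for g and e
  proof -
    have eq: "eval_mpoly g x = eval_mpoly g x'"
      by (rule eval_mpoly_cong[OF g(1)]) (simp add: x'_def)
    have "eval_mpoly g y = 0" if "eval_mpoly g x' = 0" and "y \<in> proj_point n x" for y
    proof -
      from that(2) obtain c where "y = (\<lambda>i. c * x' i)"
        by (auto simp: proj_point_def proj_rel_def x'_def)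
      with that(1) show ?thesis
        by (simp add: eval_mpoly_scale[OF g(2)])
    qed
    with self eq show ?thesis by auto
  qed
  let ?g = "extend_scalars f"
  note g = polys_upto_extend_scalars[OF f(1)] homogeneous_extend_scalars[OF f(2)]
  have "proj_point n x \<in> proj_space n"
    using x by (simp only: proj_point_in_proj_space_iff)
  then have "singular_at n f (proj_point n x) \<longleftrightarrow> (\<forall>y\<in>proj_point n x. eval_mpoly ?g y = 0) \<and>
      (\<forall>i\<le>n. \<forall>y\<in>proj_point n x. eval_mpoly (partial_deriv i ?g) y = 0)"
    unfolding singular_at_def hypersurface_def by blast
  also have "\<dots> \<longleftrightarrow> eval_mpoly ?g x = 0 \<and> (\<forall>i\<le>n. eval_mpoly (partial_deriv i ?g) x = 0)"
    by (simp only: vanish[OF g]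
        vanish[OF polys_upto_partial_deriv[OF g(1)] homogeneous_partial_deriv[OF g(2)]])
  finally show ?thesis .
qed

theorem lemma4p2:
  fixes q n k d :: nat
    and f F :: "'a::{field,finite} mpoly"
    and x :: "nat \<Rightarrow> 'a alg_closure"
  assumes "primepow q" and "card (UNIV :: 'a set) = q"
    and "k \<ge> 1" and "d \<ge> 2"
    and "f \<in> polys_upto n" and "homogeneous d f" and "f \<noteq> 0"
    and "F \<in> polys_upto (n + k)" and "F = f"
    and "\<exists>i\<le>n + k. x i \<noteq> 0"
  shows "singular_at (n + k) F (proj_point (n + k) x) \<longleftrightarrow>
           (\<forall>i\<le>n. x i = 0) \<or> proj_point n x \<in> singular_points n f"
proof -
  let ?g = "extend_scalars f"
  note g = polys_upto_extend_scalars[OF \<open>f \<in> polys_upto n\<close>]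
    homogeneous_extend_scalars[OF \<open>homogeneous d f\<close>]
  have "eval_mpoly (partial_deriv i ?g) x = 0" if "i > n" for i
    by (simp add: partial_deriv_eq_0[OF g(1) that] eval_mpoly_def)
  \<comment> \<open>The gradient conditions in n+k+1 variables reduce to those in the original n+1
    variables.\<close>
  then have "(\<forall>i\<le>n + k. eval_mpoly (partial_deriv i ?g) x = 0) \<longleftrightarrow>
      (\<forall>i\<le>n. eval_mpoly (partial_deriv i ?g) x = 0)"
    by (meson not_le trans_le_add1)
  then have cone: "singular_at (n + k) F (proj_point (n + k) x) \<longleftrightarrow>
      eval_mpoly ?g x = 0 \<and> (\<forall>i\<le>n. eval_mpoly (partial_deriv i ?g) x = 0)"
    using singular_at_proj_point_iff[of F "n + k" d x] assms by simp
  show ?thesis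
  proof (cases "\<forall>i\<le>n. x i = 0")
    case True
    have "eval_mpoly ?g x = 0"
      using True \<open>d \<ge> 2\<close> by (intro eval_mpoly_eq_0[OF g]) auto
    \<comment> \<open>Here \<open>d \<ge> 2\<close> enters in full: the derivatives have degree
      \<open>d - 1\<close>, which must be positive for them to vanish at the vertex.\<close>
    moreover have "eval_mpoly (partial_deriv i ?g) x = 0" for i
      using True \<open>d \<ge> 2\<close>
      by (intro eval_mpoly_eq_0[OF polys_upto_partial_deriv[OF g(1)]
            homogeneous_partial_deriv[OF g(2)]]) auto
    ultimately show ?thesis
      using cone True by simp
  next
    case False
    then have "\<exists>i\<le>n. x i \<noteq> 0" by simp
    \<comment> \<open>Away from the vertex \<open>x\<close> also represents a point of P^n, and the
      criterion there is the same system of equations as in \<open>cone\<close>.\<close>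
    from singular_at_proj_point_iff[OF \<open>f \<in> polys_upto n\<close> \<open>homogeneous d f\<close> this] cone False
    show ?thesis
      by (auto simp: singular_points_def singular_at_def)
  qed
qed

end
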